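(* The lottery approach, i.e. the threshold-restricted bi-level social welfare problem (SW$'$) defined in the context, yields an optimal social welfare greater than or equal to that of the FIFO dynamic pricing strategy, i.e. the optimal value of (SW$'$) is at least the optimal value of problem (DP) defined in the context.
   Context: Model. Passengers arrive at a terminal as a Poisson process of positive rate $\mu$. Drivers belong to $M$ groups; group-$m$ drivers arrive as independent Poisson processes of positive rates $\lambda_m$. Idle drivers may join a virtual queue of unlimited capacity; each arriving passenger is matched with the driver at the front of the queue (if any), who leaves. Parameters: $R_m$ is the utility a group-$m$ driver obtains from a terminal order; $T_d>0$ is the mean trip duration; $r>0$ is the drivers' utility-gaining rate outside the terminal; $\nu>0$ is the platform's profit rate outside the terminal. Drivers do not renege. $W_m^n$ is the expected waiting time in queue of a group-$m$ driver who joins at queue length $n$; $\tilde\lambda_m^n$ is the rate at which group-$m$ drivers join at queue length $n$; write $\Lambda_n=\sum_{c=1}^M\tilde\lambda_c^n$. The steady-state probabilities of queue length are (E5) $P_0=\Bigl(1+\sum_{i=1}^\infty\prod_{j=1}^i\frac{\Lambda_{j-1}}{\mu}\Bigr)^{-1}$ and $P_n=P_0\prod_{j=1}^n\frac{\Lambda_{j-1}}{\mu}$ for $n\ge1$. Lottery control. The platform chooses for each group $m$ a commission fee $p_m$ (independent of the queue length) and an entry position lottery $\Delta_m=\{\delta_m^n\}_n$, where $\delta_m^n=(\delta_m^{1,n},\dots,\delta_m^{n+1,n})$ is a probability distribution on $\{1,\dots,n+1\}$ used when the queue length upon arrival is $n$: a joining group-$m$ driver is inserted at position $l$ with probability $\delta_m^{l,n}$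 ($l=1$ is the front), and the drivers previously at positions $l,\dots,n$ each move back one position. $w_n^l$ is the expected waiting time of a driver who joins at queue length $n$ and is placed at position $l$. Problem (SW$'$): the upper level chooses capacities $N_m\in\mathbb Z^+$, $m=1,\dots,M$; set $\hat N=\max_mN_m$. The lower level maximizes, over $\{p_m\},\{\Delta_m\},\{W_m^n\}$, $$\sum_{m=1}^M\lambda_m\sum_{n=0}^{N_m-1}P_n\bigl(R_m-(r+\nu)(T_d+W_m^n)\bigr)$$ subject to (E5) and: - $\tilde\lambda_m^n=\lambda_m\mathbf 1(n<N_m)$; - $\sum_{l=1}^{n+1}\delta_m^{l,n}=1$ and $W_m^n=\sum_{l=1}^{n+1}\delta_m^{l,n}w_n^l$; - for $1\le n\le\hat N-2$, $2\le l\le n+1$: $$w_n^l=\sum_{m=1}^M\frac{\tilde\lambda_m^{n+1}}{\Lambda_{n+1}+\mu}\Bigl(\frac{1}{\Lambda_{n+1}+\mu}+\sum_{i=1}^{l}\delta_m^{i,n+1}w_{n+1}^{l+1}+\bigl(1-\sum_{i=1}^{l}\delta_m^{i,n+1}\bigr)w_{n+1}^l\Bigr)+\frac{\mu}{\Lambda_{n+1}+\mu}\Bigl(\frac1{\Lambda_{n+1}+\mu}+w_{n-1}^{l-1}\Bigr);$$ - for $0\le n\le\hat N-2$: $$w_n^1=\sum_{m=1}^M\frac{\tilde\lambda_m^{n+1}}{\Lambda_{n+1}+\mu}\Bigl(\frac{1}{\Lambda_{n+1}+\mu}+\delta_m^{1,n+1}w_{n+1}^{2}+(1-\delta_m^{1,n+1})w_{n+1}^1\Bigr)+\frac{\mu}{\Lambda_{n+1}+\mu}\cdot\frac1{\Lambda_{n+1}+\mu};$$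 - $w_{\hat N-1}^l=\frac1\mu+w_{\hat N-2}^{l-1}$ for $2\le l\le\hat N$, and $w_{\hat N-1}^1=\frac1\mu$; - $R_m-p_m-r(T_d+W_m^n)\ge0$ for all $m$ and all $n\in\{0,\dots,N_m-1\}$. The upper level maximizes the resulting lower-level optimal value over $\{N_m\}$. FIFO dynamic pricing, problem (DP): the platform sets a commission fee $p_m^n$ for each group $m$ depending on the queue length $n$ upon arrival, and every joining driver is placed at the back of the queue, so the expected waiting time of a driver joining at queue length $n$ is $W_m^n=(n+1)/\mu$. Group-$m$ drivers join at queue length $n$ at rate $\tilde\lambda_m^n=\lambda_m\mathbf 1\bigl(R_m-p_m^n-r(T_d+W_m^n)\ge0\bigr)$. Problem (DP) is to maximize the social welfare rate $\sum_{n=0}^\infty P_n\sum_{m=1}^M\tilde\lambda_m^n\bigl(R_m-(r+\nu)(T_d+W_m^n)\bigr)$ over $\{p_m^n\}$, with $P_n$ given by (E5).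
   Formalization: Capacities N_m may also be 0 (group m is never admitted); with every N_m at least 1 the claim fails, e.g. for M = 1 and R_1 = 0, where (DP) attains 0 but every feasible point of (SW′) has negative welfare. *)

theory Defs
  imports Complex_Main "HOL-Library.Extended_Real"
begin

text \<open>
  Steady-state probabilities for total joining rates \<open>L n\<close> at queue length \<open>n\<close>. If the normalizing
  series diverges, \<open>steady_prob0\<close> is read as \<open>1 / \<infinity> = 0\<close>, so every \<open>steady_prob mu L n\<close> is 0.
\<close>

definition steady_prob0 :: "real \<Rightarrow> (nat \<Rightarrow> real) \<Rightarrow> real" where
  "steady_prob0 mu L =
     (if summable (\<lambda>i. \<Prod>j=1..Suc i. L (j - 1) / mu)
      then inverse (1 + (\<Sum>i. \<Prod>j=1..Suc i. L (j - 1) / mu)) else 0)"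

definition steady_prob :: "real \<Rightarrow> (nat \<Rightarrow> real) \<Rightarrow> nat \<Rightarrow> real" where
  "steady_prob mu L n = steady_prob0 mu L * (\<Prod>j=1..n. L (j - 1) / mu)"

text \<open>
  Groups are \<open>1, \<dots>, M\<close>. Of any family indexed by groups, only the values at these indices are used.
\<close>

context
  fixes M :: nat
    and mu :: real           \<comment> \<open>passenger arrival rate\<close>
    and lam :: "nat \<Rightarrow> real"  \<comment> \<open>driver arrival rate of each group\<close>
    and R :: "nat \<Rightarrow> real"
    and Td r nu :: real
begin

definition total_rate :: "(nat \<Rightarrow> nat \<Rightarrow> real) \<Rightarrow> nat \<Rightarrow> real" where
  "total_rate rate n = (\<Sum>m=1..M. rate m n)"

definition fifo_wait :: "nat \<Rightarrow> real" where
  "fifo_wait n = (real n + 1) / mu"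

definition dp_rate :: "(nat \<Rightarrow> nat \<Rightarrow> real) \<Rightarrow> nat \<Rightarrow> nat \<Rightarrow> real" where
  "dp_rate p m n = lam m * of_bool (R m - p m n - r * (Td + fifo_wait n) \<ge> 0)"

text \<open>
  The welfare series is taken in \<^typ>\<open>ereal\<close>: for positive rates its terms are eventually
  nonpositive, so it always converges there, possibly to \<open>-\<infinity>\<close>, and no fee policy has to be excluded.
\<close>

definition dp_welfare :: "(nat \<Rightarrow> nat \<Rightarrow> real) \<Rightarrow> ereal" where
  "dp_welfare p =
     (\<Sum>n. ereal (steady_prob mu (total_rate (dp_rate p)) n *
        (\<Sum>m=1..M. dp_rate p m n * (R m - (r + nu) * (Td + fifo_wait n)))))"

definition dp_value :: ereal where
  "dp_value = (SUP p. dp_welfare p)"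

definition max_capacity :: "(nat \<Rightarrow> nat) \<Rightarrow> nat" where
  "max_capacity N = Max (N ` {1..M})"

definition sw_rate :: "(nat \<Rightarrow> nat) \<Rightarrow> nat \<Rightarrow> nat \<Rightarrow> real" where
  "sw_rate N m n = lam m * of_bool (n < N m)"

text \<open>
  \<open>d m n l\<close> is the probability that a group-\<open>m\<close> driver joining at queue length \<open>n\<close> is inserted at
  position \<open>l\<close>; only positions \<open>1, \<dots>, n + 1\<close> matter.
\<close>

definition is_lottery :: "(nat \<Rightarrow> nat \<Rightarrow> nat \<Rightarrow> real) \<Rightarrow> bool" where
  "is_lottery d \<longleftrightarrow>
     (\<forall>m\<in>{1..M}. \<forall>n. (\<forall>l\<in>{1..n + 1}. 0 \<le> d m n l) \<and> (\<Sum>l=1..n + 1. d m n l) = 1)"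

text \<open>
  \<open>w n l\<close> is the expected waiting time of a driver placed at position \<open>l\<close> on joining at queue length
  \<open>n\<close>. Bounds of the form \<open>n \<le> max_capacity N - 2\<close> are written \<open>n + 2 \<le> max_capacity N\<close> to
  avoid truncated subtraction; if all capacities are 0, no condition remains.
\<close>

definition waiting_times ::
  "(nat \<Rightarrow> nat) \<Rightarrow> (nat \<Rightarrow> nat \<Rightarrow> nat \<Rightarrow> real) \<Rightarrow> (nat \<Rightarrow> nat \<Rightarrow> real) \<Rightarrow> bool" where
  "waiting_times N d w \<longleftrightarrow>
     (let K = max_capacity N; L = total_rate (sw_rate N) in
       (\<forall>n l. 1 \<le> n \<and> n + 2 \<le> K \<and> 2 \<le> l \<and> l \<le> n + 1 \<longrightarrow>
          w n l =
            (\<Sum>m=1..M. sw_rate N m (n + 1) / (L (n + 1) + mu) *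
               (1 / (L (n + 1) + mu)
                + (\<Sum>i=1..l. d m (n + 1) i) * w (n + 1) (l + 1)
                + (1 - (\<Sum>i=1..l. d m (n + 1) i)) * w (n + 1) l))
            + mu / (L (n + 1) + mu) * (1 / (L (n + 1) + mu) + w (n - 1) (l - 1))) \<and>
       (\<forall>n. n + 2 \<le> K \<longrightarrow>
          w n 1 =
            (\<Sum>m=1..M. sw_rate N m (n + 1) / (L (n + 1) + mu) *
               (1 / (L (n + 1) + mu)
                + d m (n + 1) 1 * w (n + 1) 2
                + (1 - d m (n + 1) 1) * w (n + 1) 1))
            + mu / (L (n + 1) + mu) * (1 / (L (n + 1) + mu))) \<and>
       (\<forall>l. 2 \<le> l \<and> l \<le> K \<longrightarrow> w (K - 1) l = 1 / mu + w (K - 2) (l - 1)) \<and>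
       (1 \<le> K \<longrightarrow> w (K - 1) 1 = 1 / mu))"

definition sw_feasible ::
  "(nat \<Rightarrow> nat) \<Rightarrow> (nat \<Rightarrow> real) \<Rightarrow> (nat \<Rightarrow> nat \<Rightarrow> nat \<Rightarrow> real) \<Rightarrow> (nat \<Rightarrow> nat \<Rightarrow> real) \<Rightarrow> bool" where
  "sw_feasible N p d W \<longleftrightarrow>
     is_lottery d \<and>
     (\<exists>w. waiting_times N d w \<and>
        (\<forall>m\<in>{1..M}. \<forall>n<max_capacity N. W m n = (\<Sum>l=1..n + 1. d m n l * w n l))) \<and>
     (\<forall>m\<in>{1..M}. \<forall>n<N m. R m - p m - r * (Td + W m n) \<ge> 0)"

definition sw_welfare :: "(nat \<Rightarrow> nat) \<Rightarrow> (nat \<Rightarrow> nat \<Rightarrow> real) \<Rightarrow> real" where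
  "sw_welfare N W =
     (\<Sum>m=1..M. lam m *
        (\<Sum>n<N m. steady_prob mu (total_rate (sw_rate N)) n *
           (R m - (r + nu) * (Td + W m n))))"

definition sw_lower_value :: "(nat \<Rightarrow> nat) \<Rightarrow> ereal" where
  "sw_lower_value N = Sup {ereal (sw_welfare N W) | p d W. sw_feasible N p d W}"

text \<open>
  A capacity of 0 is allowed and means that the group is never admitted. With all capacities forced
  to be at least 1, a group with very low \<open>R m\<close> could be excluded by FIFO dynamic pricing but not here.
\<close>

definition sw_value :: ereal where
  "sw_value = (SUP N. sw_lower_value N)"

end

end

theory Submission
  imports Defs
begin

text \<open>
  The fees \<open>p m\<close> of the lottery problem may have any sign, and the lottery that always inserts at the
  back of the queue reproduces the FIFO waiting times \<open>(n + 1) / mu\<close> (lemma \<open>waiting_times_fifo\<close>).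
  Hence for every choice of capacities the lottery problem attains at least the welfare of the
  corresponding threshold policy under FIFO (lemma \<open>fifo_threshold_le_sw_value\<close>), and it suffices
  to show that no FIFO admission policy is better than the best threshold policy.

  This is a birth-death control problem with average reward. Put \<open>c = r + nu\<close>, \<open>V
  m = R m - c * Td\<close> and \<open>G x = (\<Sum>m. lam m * max 0 (V m - x))\<close>. Let \<open>d
  n\<close> be the loss of relative value when the queue grows from \<open>n - 1\<close> to
  \<open>n\<close>, and \<open>d 0 = 0\<close>; with \<open>y n = d n + c * n / mu\<close> the
  optimality equation of the problem reads \<open>G (y (n + 1)) + mu * y n = g + c * n\<close> and
  \<open>y 0 = 0\<close>, where \<open>g\<close> is the optimal welfare rate. For a given
  \<open>g\<close> this is an explicit recursion downwards in \<open>n\<close>, started at a length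
  beyond which \<open>G (y n) = 0\<close>, so that \<open>y n = (g + c * n) / mu\<close> there. It
  makes \<open>y\<close> nondecreasing in \<open>n\<close>, since \<open>G\<close> is nonincreasing,
  and its value at \<open>0\<close> is continuous in \<open>g\<close>, so the intermediate value
  theorem supplies a \<open>g \<ge> 0\<close> with \<open>y 0 = 0\<close> (lemma
  \<open>optimality_equation_solution\<close>).

  Multiplying the optimality equation by the stationary weights and summing telescopes by the balance
  equations. This bounds the welfare of every policy by \<open>g\<close>. A policy that admits group \<open>m\<close> at
  length \<open>n\<close> exactly when \<open>y (n + 1) < V m\<close> attains \<open>g\<close>, and it is a threshold policy because \<open>y\<close> is
  nondecreasing.
\<close>

section \<open>The optimality equation\<close>

text \<open>
  The solution of \<open>G (y (n + 1)) + mu * y n = g + c * n\<close> at index \<open>K - k\<close> for \<open>k \<le> K\<close>,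
  computed downwards from the
  value \<open>(g + c * K) / mu\<close> at index \<open>K\<close>.
\<close>

primrec backward_value ::
  "(real \<Rightarrow> real) \<Rightarrow> real \<Rightarrow> real \<Rightarrow> nat \<Rightarrow> nat \<Rightarrow> real \<Rightarrow> real" where
  "backward_value G mu c K 0 g = (g + c * real K) / mu"
| "backward_value G mu c K (Suc k) g =
     (g + c * (real K - real (Suc k)) - G (backward_value G mu c K k g)) / mu"

lemma mono_backward_value:
  assumes "mu > 0" "antimono G" "g \<le> g'"
  shows "backward_value G mu c K k g \<le> backward_value G mu c K k g'"
proof (induction k)
  case 0
  then show ?case using assms by (simp add: divide_right_mono)
next
  case (Suc k)
  have "G (backward_value G mu c K k g') \<le> G (backward_value G mu c K k g)"
    using Suc assms(2) by (simp add: antimonoD)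
  then show ?case using assms by (simp add: divide_right_mono)
qed

lemma continuous_on_backward_value:
  assumes "mu \<noteq> 0" "continuous_on UNIV G"
  shows "continuous_on UNIV (backward_value G mu c K k)"
proof (induction k)
  case 0
  show ?case using assms(1) by (auto intro!: continuous_intros)
next
  case (Suc k)
  have "continuous_on UNIV (\<lambda>g. G (backward_value G mu c K k g))"
    using continuous_on_compose2[OF assms(2) Suc] by simp
  then show ?case using assms(1) by (auto intro!: continuous_intros)
qed

lemma optimality_equation_solution:
  fixes G :: "real \<Rightarrow> real"
  assumes mu: "mu > 0" and c: "c > 0"
    and anti: "antimono G" and cont: "continuous_on UNIV G"
    and nonneg: "\<And>x. G x \<ge> 0" and zero: "\<And>x. x \<ge> v \<Longrightarrow> G x = 0"
  obtains g y K where "g \<ge> 0" "y 0 = 0"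
    "\<And>n. G (y (Suc n)) + mu * y n = g + c * real n"
    "mono y" "\<And>n. n \<ge> K \<Longrightarrow> y n = (g + c * real n) / mu"
proof -
  obtain K0 :: nat where K0: "mu * v / c < real K0"
    using reals_Archimedean2 by blast
  define K where "K = Suc K0"
  have K: "v \<le> c * real n / mu" if "n \<ge> K" for n
  proof -
    have "mu * v < c * real K0" using K0 c by (simp add: field_simps)
    also have "\<dots> \<le> c * real n" using that c by (simp add: K_def)
    finally show ?thesis using mu by (simp add: field_simps)
  qed
  let ?Y = "backward_value G mu c K"
  have "\<exists>g\<ge>0. g \<le> G (?Y K0 0) \<and> ?Y K g = 0"
  proof (rule IVT'[where f = "?Y K"])
    show "?Y K 0 \<le> 0"
      using nonneg mu by (simp add: K_def divide_nonpos_pos)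
    have "?Y K0 0 \<le> ?Y K0 (G (?Y K0 0))"
      by (rule mono_backward_value[OF mu anti nonneg])
    then show "0 \<le> ?Y K (G (?Y K0 0))"
      using mu anti by (simp add: K_def antimonoD)
    show "continuous_on {0..G (?Y K0 0)} (?Y K)"
      using continuous_on_backward_value[OF _ cont] mu
      by (metis continuous_on_subset less_numeral_extra(3) top_greatest)
  qed (simp add: nonneg)
  then obtain g where g: "g \<ge> 0" "?Y K g = 0" by blast
  define y where "y n = (if n \<le> K then ?Y (K - n) g else (g + c * real n) / mu)" for n
  have large: "y n = (g + c * real n) / mu" if "n \<ge> K" for n
    using that by (cases "n = K") (auto simp: y_def)
  have eq: "G (y (Suc n)) + mu * y n = g + c * real n" for n
  proof (cases "n < K")
    case True
    then have "K - n = Suc (K - Suc n)" by simp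
    moreover have "real K - real (Suc (K - Suc n)) = real n"
      using True by (simp add: of_nat_diff)
    ultimately have "y n = (g + c * real n - G (y (Suc n))) / mu"
      using True unfolding y_def by (simp del: of_nat_Suc)
    then show ?thesis using mu by simp
  next
    case False
    have "v \<le> y (Suc n)"
    proof -
      have "v \<le> c * real (Suc n) / mu" using K[of "Suc n"] False by simp
      also have "\<dots> \<le> y (Suc n)"
        using large False g mu by (simp add: divide_right_mono)
      finally show ?thesis .
    qed
    then show ?thesis using zero large[of n] False mu by simp
  qed
  have step_large: "y n \<le> y (Suc n)" if "n \<ge> K" for n
    using that large[of n] large[of "Suc n"] mu c by (simp add: divide_right_mono)
  have step_small: "y (K - k) \<le> y (Suc (K - k))" for k
  proof (induction k)
    case 0
    show ?case using step_large by simp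
  next
    case (Suc k)
    show ?case
    proof (cases "k < K")
      case True
      define n where "n = K - Suc k"
      have n: "K - k = Suc n" using True by (simp add: n_def)
      have "G (y (Suc (Suc n))) \<le> G (y (Suc n))"
        using Suc n anti by (simp add: antimonoD)
      moreover have "c * real n \<le> c * real (Suc n)" using c by simp
      ultimately have "mu * y n \<le> mu * y (Suc n)"
        using eq[of n] eq[of "Suc n"] by linarith
      then show ?thesis using mu by (simp add: n_def)
    next
      case False
      then show ?thesis using Suc by simp
    qed
  qed
  have "y n \<le> y (Suc n)" for n
    using step_large[of n] step_small[of "K - n"] by (cases "n \<le> K") simp_all
  then have "mono y" by (simp add: mono_iff_le_Suc)
  moreover have "y 0 = 0" using g by (simp add: y_def)
  ultimately show ?thesis using that g(1) eq large by blast
qed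

section \<open>Stationary weights of a birth-death chain\<close>

text \<open>The unnormalized stationary weight of queue length \<open>n\<close> for birth rates \<open>L\<close> and death rate \<open>mu\<close>.\<close>

definition bd_weight :: "real \<Rightarrow> (nat \<Rightarrow> real) \<Rightarrow> nat \<Rightarrow> real" where
  "bd_weight mu L n = (\<Prod>j=1..n. L (j - 1) / mu)"

lemma bd_weight_0 [simp]: "bd_weight mu L 0 = 1"
  and bd_weight_Suc: "bd_weight mu L (Suc n) = bd_weight mu L n * L n / mu"
  by (simp_all add: bd_weight_def)

lemma bd_weight_nonneg:
  assumes "mu > 0" "\<And>n. L n \<ge> 0"
  shows "bd_weight mu L n \<ge> 0"
  unfolding bd_weight_def by (intro prod_nonneg) (use assms in auto)

lemma steady_prob_altdef: "steady_prob mu L n = steady_prob0 mu L * bd_weight mu L n"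
  by (simp add: steady_prob_def bd_weight_def)

lemma steady_prob0_altdef:
  "steady_prob0 mu L =
     (if summable (bd_weight mu L) then inverse (\<Sum>n. bd_weight mu L n) else 0)"
proof -
  have "summable (\<lambda>i. bd_weight mu L (Suc i)) = summable (bd_weight mu L)"
    by (rule summable_Suc_iff)
  moreover have "(\<Sum>n. bd_weight mu L n) = 1 + (\<Sum>i. bd_weight mu L (Suc i))"
    if "summable (bd_weight mu L)"
    using suminf_split_head[OF that] by simp
  ultimately show ?thesis
    unfolding steady_prob0_def bd_weight_def[symmetric] by auto
qed

lemma steady_prob_nonneg:
  assumes "mu > 0" "\<And>n. L n \<ge> 0"
  shows "steady_prob mu L n \<ge> 0"
  unfolding steady_prob_altdef steady_prob0_altdef
  by (auto intro!: mult_nonneg_nonneg suminf_nonneg bd_weight_nonneg[OF assms])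

lemma sum_steady_prob_le_1:
  assumes "mu > 0" "\<And>n. L n \<ge> 0"
  shows "(\<Sum>n<k. steady_prob mu L n) \<le> 1"
proof (cases "summable (bd_weight mu L)")
  case True
  have "(\<Sum>n<k. bd_weight mu L n) \<le> suminf (bd_weight mu L)"
    by (rule sum_le_suminf[OF True]) (auto intro: bd_weight_nonneg[OF assms])
  moreover have "suminf (bd_weight mu L) \<ge> 1"
    using sum_le_suminf[OF True, of "{0}"] by (simp add: bd_weight_nonneg[OF assms])
  ultimately show ?thesis
    unfolding steady_prob_altdef sum_distrib_left[symmetric]
    by (simp add: steady_prob0_altdef True divide_inverse_commute[symmetric])
qed (simp add: steady_prob_altdef steady_prob0_altdef)

lemma
  assumes "mu > 0" "\<And>n. L n \<ge> 0" "\<And>n. n \<ge> k \<Longrightarrow> L n = 0"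
  shows steady_prob_eq_0: "steady_prob mu L (Suc k) = 0"
    and sum_steady_prob_eq_1: "(\<Sum>n<Suc k. steady_prob mu L n) = 1"
proof -
  have zero: "bd_weight mu L n = 0" if "n \<ge> Suc k" for n
    using that assms(3) by (cases n) (auto simp: bd_weight_Suc)
  show "steady_prob mu L (Suc k) = 0"
    by (simp add: steady_prob_altdef zero)
  have sums: "bd_weight mu L sums (\<Sum>n<Suc k. bd_weight mu L n)"
    by (rule sums_finite) (use zero in \<open>auto simp: not_less\<close>)
  have "(\<Sum>n<Suc k. bd_weight mu L n) \<ge> (\<Sum>n\<in>{0}. bd_weight mu L n)"
    by (rule sum_mono2) (auto intro: bd_weight_nonneg[OF assms(1,2)])
  then show "(\<Sum>n<Suc k. steady_prob mu L n) = 1"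
    using sums
    unfolding steady_prob_altdef sum_distrib_left[symmetric]
    by (simp add: steady_prob0_altdef sums_iff del: sum.lessThan_Suc)
qed

text \<open>
  The balance equations \<open>P n * L n = mu * P (n + 1)\<close> make the expected drift of a potential with
  increments \<open>d\<close> telescope.
\<close>

lemma sum_steady_prob_drift:
  assumes "mu \<noteq> 0" "d 0 = (0 :: real)"
  shows "(\<Sum>n<k. steady_prob mu L n * (L n * d (Suc n) - mu * d n)) = mu * steady_prob mu L k * d k"
proof (induction k)
  case (Suc k)
  have "mu * steady_prob mu L (Suc k) = steady_prob mu L k * L k"
    using assms(1) by (simp add: steady_prob_altdef bd_weight_Suc)
  then show ?case using Suc by (simp add: right_diff_distrib mult.assoc)
qed (simp add: assms(2))

text \<open>
  Terms that are eventually nonpositive have a sum in the extended reals, so bounds on the partial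
  sums carry over without any assumption of convergence in the reals.
\<close>

lemma suminf_ereal_le:
  fixes f :: "nat \<Rightarrow> real"
  assumes "\<And>n. n \<ge> K \<Longrightarrow> f n \<le> 0" and "\<And>k. k \<ge> K \<Longrightarrow> (\<Sum>n<k. f n) \<le> g"
  shows "(\<Sum>n. ereal (f n)) \<le> ereal g"
proof -
  let ?S = "\<lambda>k. \<Sum>n<k + K. ereal (f n)"
  have "decseq ?S"
    using assms(1) by (intro decseq_SucI) (simp add: sum_ereal)
  then have "?S \<longlonglongrightarrow> (INF k. ?S k)" by (rule LIMSEQ_INF)
  then have "(\<lambda>n. ereal (f n)) sums (INF k. ?S k)"
    unfolding sums_def by (rule LIMSEQ_offset)
  moreover have "(INF k. ?S k) \<le> ereal g"
    by (rule INF_lower2[of 0]) (use assms(2)[of K] in \<open>simp_all add: sum_ereal\<close>)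
  ultimately show ?thesis by (simp add: sums_iff)
qed

section \<open>FIFO threshold policies as lotteries\<close>

text \<open>
  Inserting at the back never displaces anyone, so position \<open>l\<close> waits for exactly \<open>l\<close> passengers,
  whatever the queue length.
\<close>

lemma waiting_times_fifo:
  fixes M :: nat and lam :: "nat \<Rightarrow> real"
  assumes mu: "mu > 0" and lam: "\<And>m. m \<in> {1..M} \<Longrightarrow> lam m \<ge> 0"
  shows "waiting_times M mu lam N (\<lambda>m n l. of_bool (l = n + 1)) (\<lambda>n l. real l / mu)"
proof -
  let ?L = "total_rate M (sw_rate lam N)"
  have L: "?L n \<ge> 0" for n
    unfolding total_rate_def by (intro sum_nonneg) (use lam in \<open>auto simp: sw_rate_def\<close>)
  have "(\<Sum>i=1..l. of_bool (i = n + 1 + 1) :: real) = 0" if "l \<le> n + 1" for l n :: nat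
    by (rule sum.neutral) (use that in auto)
  note no_overtaking = this
  have "real l / mu = (\<Sum>m=1..M. sw_rate lam N m (n + 1) / (?L (n + 1) + mu) *
          (1 / (?L (n + 1) + mu) + real l / mu))
        + mu / (?L (n + 1) + mu) * (1 / (?L (n + 1) + mu) + (real l - 1) / mu)" for n l
  proof -
    define a where "a = ?L (n + 1)"
    have a: "a + mu > 0" using L[of "n + 1"] mu by (simp add: a_def)
    have "(\<Sum>m=1..M. sw_rate lam N m (n + 1) / (a + mu) * (1 / (a + mu) + real l / mu))
        = a / (a + mu) * (1 / (a + mu) + real l / mu)"
      unfolding sum_distrib_right[symmetric] sum_divide_distrib[symmetric]
      by (simp add: a_def total_rate_def)
    moreover have "a / (a + mu) * (1 / (a + mu) + real l / mu)
        + mu / (a + mu) * (1 / (a + mu) + (real l - 1) / mu) = real l / mu"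
    proof -
      define t where "t = mu / (a + mu)"
      have t: "a / (a + mu) = 1 - t"
        using a by (simp add: t_def field_simps)
      have t': "t / mu = 1 / (a + mu)"
        using mu by (simp add: t_def)
      show ?thesis
        unfolding t t_def[symmetric] t'[symmetric]
        by (simp add: algebra_simps diff_divide_distrib)
    qed
    ultimately show ?thesis unfolding a_def[symmetric] by simp
  qed
  note recursion = this
  show ?thesis
    unfolding waiting_times_def Let_def
  proof (intro conjI allI impI)
    fix n l :: nat
    assume *: "1 \<le> n \<and> n + 2 \<le> max_capacity M N \<and> 2 \<le> l \<and> l \<le> n + 1"
    then have "real (l - 1) = real l - 1" by (simp add: of_nat_diff)
    then show "real l / mu = (\<Sum>m=1..M. sw_rate lam N m (n + 1) / (?L (n + 1) + mu) *
          (1 / (?L (n + 1) + mu) + (\<Sum>i=1..l. of_bool (i = n + 1 + 1)) * (real (l + 1) / mu)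
            + (1 - (\<Sum>i=1..l. of_bool (i = n + 1 + 1))) * (real l / mu)))
        + mu / (?L (n + 1) + mu) * (1 / (?L (n + 1) + mu) + real (l - 1) / mu)"
      using recursion[of l n] no_overtaking[of l n] * by simp
  next
    fix n :: nat
    show "real 1 / mu = (\<Sum>m=1..M. sw_rate lam N m (n + 1) / (?L (n + 1) + mu) *
          (1 / (?L (n + 1) + mu) + of_bool (1 = n + 1 + 1) * (real 2 / mu)
            + (1 - of_bool (1 = n + 1 + 1)) * (real 1 / mu)))
        + mu / (?L (n + 1) + mu) * (1 / (?L (n + 1) + mu))"
      using recursion[of 1 n] by simp
  qed (auto simp: of_nat_diff diff_divide_distrib)
qed

text \<open>
  FIFO waiting times increase with the queue length, so a fee that makes a driver indifferent at
  length \<open>N m\<close>, possibly a negative one, makes joining worthwhile at every smaller length.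
\<close>

lemma sw_feasible_fifo:
  fixes M :: nat and lam :: "nat \<Rightarrow> real"
  assumes mu: "mu > 0" and lam: "\<And>m. m \<in> {1..M} \<Longrightarrow> lam m \<ge> 0" and r: "r \<ge> 0"
  shows "sw_feasible M mu lam R Td r N (\<lambda>m. R m - r * (Td + fifo_wait mu (N m)))
           (\<lambda>m n l. of_bool (l = n + 1)) (\<lambda>m. fifo_wait mu)"
  unfolding sw_feasible_def
proof (intro conjI exI)
  show "is_lottery M (\<lambda>m n l. of_bool (l = n + 1))"
    by (simp add: is_lottery_def)
  show "waiting_times M mu lam N (\<lambda>m n l. of_bool (l = n + 1)) (\<lambda>n l. real l / mu)"
    using waiting_times_fifo[OF mu lam] .
  show "\<forall>m\<in>{1..M}. \<forall>n<max_capacity M N.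
      fifo_wait mu n = (\<Sum>l=1..n + 1. of_bool (l = n + 1) * (real l / mu))"
    by (simp add: fifo_wait_def add.commute)
  show "\<forall>m\<in>{1..M}. \<forall>n<N m.
      0 \<le> R m - (R m - r * (Td + fifo_wait mu (N m))) - r * (Td + fifo_wait mu n)"
  proof (intro ballI allI impI)
    fix m n assume "n < N m"
    then have "fifo_wait mu n \<le> fifo_wait mu (N m)"
      using mu by (simp add: fifo_wait_def divide_right_mono)
    then have "r * (Td + fifo_wait mu n) \<le> r * (Td + fifo_wait mu (N m))"
      using r by (intro mult_left_mono) auto
    then show "0 \<le> R m - (R m - r * (Td + fifo_wait mu (N m))) - r * (Td + fifo_wait mu n)"
      by simp
  qed
qed

lemma fifo_threshold_le_sw_value:
  fixes M :: nat and lam :: "nat \<Rightarrow> real"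
  assumes "mu > 0" "\<And>m. m \<in> {1..M} \<Longrightarrow> lam m \<ge> 0" "r \<ge> 0"
  shows "ereal (sw_welfare M mu lam R Td r nu N (\<lambda>m. fifo_wait mu)) \<le> sw_value M mu lam R Td r nu"
proof -
  have "ereal (sw_welfare M mu lam R Td r nu N (\<lambda>m. fifo_wait mu))
      \<le> sw_lower_value M mu lam R Td r nu N"
    unfolding sw_lower_value_def
    by (rule Sup_upper) (auto intro!: exI sw_feasible_fifo[OF assms])
  also have "\<dots> \<le> sw_value M mu lam R Td r nu"
    unfolding sw_value_def by (rule SUP_upper) simp
  finally show ?thesis .
qed

lemma sw_welfare_eq_sum:
  fixes M :: nat
  assumes "\<And>m. m \<in> {1..M} \<Longrightarrow> N m \<le> k"
  shows "sw_welfare M mu lam R Td r nu N W =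
    (\<Sum>n<k. steady_prob mu (total_rate M (sw_rate lam N)) n *
       (\<Sum>m=1..M. sw_rate lam N m n * (R m - (r + nu) * (Td + W m n))))"
proof -
  let ?P = "steady_prob mu (total_rate M (sw_rate lam N))"
  have "lam m * (\<Sum>n<N m. ?P n * (R m - (r + nu) * (Td + W m n)))
      = (\<Sum>n<k. ?P n * (sw_rate lam N m n * (R m - (r + nu) * (Td + W m n))))"
    if "m \<in> {1..M}" for m
  proof -
    have "(\<Sum>n<k. ?P n * (sw_rate lam N m n * (R m - (r + nu) * (Td + W m n))))
        = (\<Sum>n<N m. ?P n * (sw_rate lam N m n * (R m - (r + nu) * (Td + W m n))))"
      by (rule sum.mono_neutral_right) (use assms[OF that] in \<open>auto simp: sw_rate_def\<close>)
    also have "\<dots> = lam m * (\<Sum>n<N m. ?P n * (R m - (r + nu) * (Td + W m n)))"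
      unfolding sum_distrib_left by (rule sum.cong) (auto simp: sw_rate_def)
    finally show ?thesis ..
  qed
  then have "sw_welfare M mu lam R Td r nu N W
      = (\<Sum>m=1..M. \<Sum>n<k. ?P n * (sw_rate lam N m n * (R m - (r + nu) * (Td + W m n))))"
    unfolding sw_welfare_def by (rule sum.cong[OF refl])
  also have "\<dots> = (\<Sum>n<k. ?P n * (\<Sum>m=1..M. sw_rate lam N m n * (R m - (r + nu) * (Td + W m n))))"
    by (subst sum.swap) (simp add: sum_distrib_left)
  finally show ?thesis .
qed

section \<open>Optimality of a threshold policy\<close>

theorem proposition7:
  fixes M :: nat
    and mu Td r nu :: real
    and lam R :: "nat \<Rightarrow> real"
  assumes "M \<ge> 1"
    and "mu > 0"
    and "\<And>m. m \<in> {1..M} \<Longrightarrow> lam m > 0"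
    and "Td > 0"
    and "r > 0"
    and "nu > 0"
  shows "sw_value M mu lam R Td r nu \<ge> dp_value M mu lam R Td r nu"
proof -
  note mu = assms(2)
  define c where "c = r + nu"
  have c: "c > 0" using assms by (simp add: c_def)
  have lam: "lam m \<ge> 0" if "m \<in> {1..M}" for m using assms(3)[OF that] by simp
  define V where "V m = R m - c * Td" for m
  define G where "G x = (\<Sum>m=1..M. lam m * max 0 (V m - x))" for x
  define v where "v = (\<Sum>m=1..M. \<bar>V m\<bar>)"
  have V_le_v: "V m \<le> v" if "m \<in> {1..M}" for m
  proof -
    have "V m \<le> \<bar>V m\<bar>" by simp
    also have "\<dots> \<le> v" unfolding v_def by (rule member_le_sum) (use that in auto)
    finally show ?thesis .
  qed
  have "antimono G"
    unfolding G_def by (intro antimonoI sum_mono mult_left_mono) (use lam in auto)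
  moreover have "continuous_on UNIV G"
    unfolding G_def by (intro continuous_intros)
  moreover have "G x \<ge> 0" for x
    unfolding G_def by (intro sum_nonneg mult_nonneg_nonneg) (use lam in auto)
  moreover have "G x = 0" if "x \<ge> v" for x
    unfolding G_def by (rule sum.neutral) (use V_le_v that in force)
  ultimately obtain g y K where g: "g \<ge> 0" and y0: "y 0 = 0"
    and eq: "\<And>n. G (y (Suc n)) + mu * y n = g + c * real n"
    and mono: "mono y" and large: "\<And>n. n \<ge> K \<Longrightarrow> y n = (g + c * real n) / mu"
    using optimality_equation_solution[OF mu c, of G v] by metis
  \<comment> \<open>In terms of \<open>y\<close> the admission test compares with a monotone sequence; in terms of \<open>d\<close> the
      optimality equation telescopes.\<close>
  define d where "d n = y n - c * real n / mu" for n
  have d0: "d 0 = 0" by (simp add: d_def y0)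
  obtain K' where K': "K' \<ge> K" "\<And>n m. n \<ge> K' \<Longrightarrow> m \<in> {1..M} \<Longrightarrow> V m \<le> c * real n / mu"
  proof -
    obtain K0 :: nat where K0: "mu * v / c < real K0"
      using reals_Archimedean2 by blast
    show thesis
    proof (rule that[of "max K K0"])
      fix n m assume n: "n \<ge> max K K0" and m: "m \<in> {1..M}"
      have "mu * v < c * real K0" using K0 c by (simp add: field_simps)
      also have "\<dots> \<le> c * real n" using n c by simp
      finally have "v \<le> c * real n / mu" using mu by (simp add: field_simps)
      then show "V m \<le> c * real n / mu" using V_le_v[OF m] by simp
    qed simp
  qed
  have reward_shift: "R m - (r + nu) * (Td + fifo_wait mu n) = V m - y (Suc n) + d (Suc n)" for m n
    by (simp add: V_def d_def fifo_wait_def c_def algebra_simps add_divide_distrib)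
  define reward where
    "reward a n = (\<Sum>m=1..M. a m n * (R m - (r + nu) * (Td + fifo_wait mu n)))"
    for a :: "nat \<Rightarrow> nat \<Rightarrow> real" and n
  have reward_eq: "reward a n =
      (\<Sum>m=1..M. a m n * (V m - y (Suc n))) + total_rate M a n * d (Suc n)" for a n
    unfolding reward_def reward_shift total_rate_def
    by (simp add: distrib_left sum.distrib sum_distrib_right)
  have eq_d: "G (y (Suc n)) = g - mu * d n" for n
    using eq[of n] mu by (simp add: d_def right_diff_distrib)

  have "dp_welfare M mu lam R Td r nu p \<le> ereal g" for p
  proof -
    let ?a = "dp_rate mu lam R Td r p"
    let ?L = "total_rate M ?a"
    let ?P = "steady_prob mu ?L"
    have a: "0 \<le> ?a m n" if "m \<in> {1..M}" for m n
      using lam[OF that] by (simp add: dp_rate_def)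
    have L: "?L n \<ge> 0" for n
      unfolding total_rate_def by (intro sum_nonneg a)
    have P: "?P n \<ge> 0" for n
      by (rule steady_prob_nonneg[OF mu L])
    have reward_le: "reward ?a n \<le> g + (?L n * d (Suc n) - mu * d n)" for n
    proof -
      have "(\<Sum>m=1..M. ?a m n * (V m - y (Suc n))) \<le> G (y (Suc n))"
        unfolding G_def
      proof (rule sum_mono)
        fix m assume "m \<in> {1..M}"
        then show "?a m n * (V m - y (Suc n)) \<le> lam m * max 0 (V m - y (Suc n))"
          using lam[of m] by (auto simp: dp_rate_def intro: mult_left_mono)
      qed
      then show ?thesis unfolding reward_eq using eq_d[of n] by simp
    qed
    have "(\<Sum>n. ereal (?P n * reward ?a n)) \<le> ereal g"
    proof (rule suminf_ereal_le[where K = K'])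
      fix n assume n: "n \<ge> K'"
      have "reward ?a n \<le> 0"
        unfolding reward_def
      proof (intro sum_nonpos mult_nonneg_nonpos a)
        fix m assume "m \<in> {1..M}"
        then show "R m - (r + nu) * (Td + fifo_wait mu n) \<le> 0"
          using K'(2)[of "Suc n" m] n
          by (simp add: V_def c_def fifo_wait_def algebra_simps add_divide_distrib)
      qed
      then show "?P n * reward ?a n \<le> 0"
        using P[of n] by (simp add: mult_nonneg_nonpos)
    next
      fix k assume k: "k \<ge> K'"
      have "(\<Sum>n<k. ?P n * reward ?a n) \<le> (\<Sum>n<k. ?P n * (g + (?L n * d (Suc n) - mu * d n)))"
        by (intro sum_mono mult_left_mono reward_le P)
      also have "\<dots> = (\<Sum>n<k. ?P n) * g + (\<Sum>n<k. ?P n * (?L n * d (Suc n) - mu * d n))"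
        by (simp add: distrib_left sum.distrib sum_distrib_right)
      also have "\<dots> = (\<Sum>n<k. ?P n) * g + mu * ?P k * d k"
        using sum_steady_prob_drift[where d = d and mu = mu] mu d0 by simp
      \<comment> \<open>Here \<open>mu * d k = g\<close>, so the boundary term is just the mass of the next state.\<close>
      also have "mu * ?P k * d k = ?P k * g"
        using large[of k] k K'(1) mu by (simp add: d_def add_divide_distrib)
      also have "(\<Sum>n<k. ?P n) * g + ?P k * g = (\<Sum>n<Suc k. ?P n) * g"
        by (simp add: distrib_right)
      also have "\<dots> \<le> 1 * g"
        by (intro mult_right_mono sum_steady_prob_le_1[OF mu L] g)
      finally show "(\<Sum>n<k. ?P n * reward ?a n) \<le> g" by simp
    qed
    then show ?thesis by (simp add: dp_welfare_def reward_def)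
  qed
  then have "dp_value M mu lam R Td r nu \<le> ereal g"
    unfolding dp_value_def by (intro SUP_least)

  also have "ereal g \<le> sw_value M mu lam R Td r nu"
  proof -
    define N where "N m = (LEAST n. V m \<le> y (Suc n))" for m
    have ex: "V m \<le> y (Suc K')" if "m \<in> {1..M}" for m
    proof -
      have "V m \<le> c * real (Suc K') / mu" using K'(2)[of "Suc K'" m] that by simp
      also have "\<dots> \<le> y (Suc K')"
        using large[of "Suc K'"] K'(1) g mu by (simp add: divide_right_mono)
      finally show ?thesis .
    qed
    have N_le: "N m \<le> K'" if "m \<in> {1..M}" for m
      unfolding N_def using ex[OF that] by (rule Least_le)
    have admit: "n < N m \<longleftrightarrow> y (Suc n) < V m" if "m \<in> {1..M}" for m n
    proof
      assume "n < N m"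
      then show "y (Suc n) < V m"
        unfolding N_def using not_less_Least by fastforce
    next
      assume n: "y (Suc n) < V m"
      have "V m \<le> y (Suc (N m))"
        unfolding N_def using ex[OF that] by (rule LeastI)
      then have "\<not> y (Suc (N m)) \<le> y (Suc n)" using n by simp
      then show "n < N m" using monoD[OF mono, of "Suc (N m)" "Suc n"] by force
    qed
    let ?a = "sw_rate lam N"
    let ?L = "total_rate M ?a"
    let ?P = "steady_prob mu ?L"
    have L: "?L n \<ge> 0" for n
      unfolding total_rate_def by (intro sum_nonneg) (use lam in \<open>auto simp: sw_rate_def\<close>)
    have L0: "?L n = 0" if "n \<ge> K'" for n
      unfolding total_rate_def by (rule sum.neutral) (use that N_le in \<open>force simp: sw_rate_def\<close>)
    have reward: "reward ?a n = g + (?L n * d (Suc n) - mu * d n)" for n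
    proof -
      have "(\<Sum>m=1..M. ?a m n * (V m - y (Suc n))) = G (y (Suc n))"
        unfolding G_def by (rule sum.cong) (auto simp: sw_rate_def admit)
      then show ?thesis unfolding reward_eq using eq_d[of n] by simp
    qed
    have "sw_welfare M mu lam R Td r nu N (\<lambda>m. fifo_wait mu) = (\<Sum>n<Suc K'. ?P n * reward ?a n)"
      unfolding reward_def by (rule sw_welfare_eq_sum) (use N_le in force)
    also have "\<dots> = (\<Sum>n<Suc K'. ?P n) * g
        + (\<Sum>n<Suc K'. ?P n * (?L n * d (Suc n) - mu * d n))"
      unfolding reward by (simp only: distrib_left sum.distrib sum_distrib_right)
    also have "\<dots> = g"
      using sum_steady_prob_drift[where d = d and mu = mu and k = "Suc K'" and L = ?L] mu d0
        steady_prob_eq_0[OF mu L L0] sum_steady_prob_eq_1[OF mu L L0] by simp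
    finally show ?thesis
      using fifo_threshold_le_sw_value[where M = M and lam = lam and r = r and N = N] mu lam assms(5)
      by (metis less_imp_le)
  qed
  finally show ?thesis .
qed

end
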